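(* Let $p$ be an odd prime and $n\ge 2$, and let $\lambda\in\mathbb Z_p^\times$ be a nonsquare modulo $p$. A complete set of (pairwise inequivalent) representatives for the double cosets $\overline{K_n}\backslash\overline{K}/\overline{K_n}$ is given by $$(I,1),\quad (w(1),1),\quad (y(p^r),1),\quad (y(\lambda p^r),1)\qquad (1\le r\le n-1).$$
   Context: Let $G=\mathrm{SL}_2(\mathbb Q_p)$, $K=\mathrm{SL}_2(\mathbb Z_p)$ and $K_n=K_0(p^n)=\{\begin{pmatrix}a&b\\ c&d\end{pmatrix}\in K: c\in p^n\mathbb Z_p\}$. $(\cdot,\cdot)_p$ is the quadratic Hilbert symbol of $\mathbb Q_p$. For $A=\begin{pmatrix}a&b\\ c&d\end{pmatrix}$ put $\tau(A)=c$ if $c\neq0$ and $\tau(A)=d$ if $c=0$; for $g=\begin{pmatrix}a&b\\ c&d\end{pmatrix}\in G$ put $s_p(g)=(c,d)_p$ if $cd\ne0$ and $\mathrm{ord}_p(c)$ is odd, and $s_p(g)=1$ otherwise. Put $\sigma_0(g,h)=(\tau(gh)\tau(g),\tau(gh)\tau(h))_p$ and $c(g,h)=\sigma_0(g,h)s_p(g)s_p(h)s_p(gh)$. The metaplectic double cover $\widetilde G$ is the set $G\times\{\pm1\}$ with $(g,\epsilon_1)(h,\epsilon_2)=(gh,\epsilon_1\epsilon_2c(g,h))$. For a subgroup $S\subset G$, $\overline S$ is its full inverse image in $\widetilde G$. For odd $p$ the cover splits over $K$ by $k\mapsto(k,1)$. Notation: $y(s)=\begin{pmatrix}1&0\\ s&1\end{pmatrix}$,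 $w(t)=\begin{pmatrix}0&t\\ -t^{-1}&0\end{pmatrix}$. *)

theory Defs
  imports
    "HOL-Analysis.Analysis"
    "HOL-Algebra.Coset"
    "HOL-Computational_Algebra.Polynomial_Factorial"
    "Berlekamp_Zassenhaus.Finite_Field"
begin

text \<open>
  The prime is carried by a type parameter: \<open>p = CARD('p)\<close> for \<open>'p :: prime_card\<close>.
  A p-adic integer is a compatible family of residues modulo the powers of p, each
  represented by its least nonnegative representative (the inverse limit of the rings
  of integers modulo the n-th power of p).
\<close>

typedef (overloaded) ('p::prime_card) padic_int =
  "{x :: nat \<Rightarrow> int. \<forall>n. x n \<in> {0..<int CARD('p) ^ n} \<and> x (Suc n) mod int CARD('p) ^ n = x n}"
  by (rule exI[of _ "\<lambda>_. 0"]) auto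

setup_lifting type_definition_padic_int

lemma mod_power_Suc_mod:
  "(a mod (q::int) ^ Suc n) mod q ^ n = a mod q ^ n"
  by (rule mod_mod_cancel) simp

lemma prime_card_power_pos: "0 < int CARD('p::prime_card) ^ n"
  by simp

instantiation padic_int :: (prime_card) comm_ring_1
begin

lift_definition zero_padic_int :: "'a padic_int" is "\<lambda>_. 0"
  by simp

lift_definition one_padic_int :: "'a padic_int" is "\<lambda>n. 1 mod int CARD('a) ^ n"
  by (auto simp only: mod_power_Suc_mod atLeastLessThan_iff prime_card_power_pos
      pos_mod_sign pos_mod_bound)

lift_definition plus_padic_int :: "'a padic_int \<Rightarrow> 'a padic_int \<Rightarrow> 'a padic_int"
  is "\<lambda>x y n. (x n + y n) mod int CARD('a) ^ n"
  by (simp only: mod_power_Suc_mod atLeastLessThan_iff prime_card_power_pos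
      pos_mod_sign pos_mod_bound) (metis mod_add_eq)

lift_definition uminus_padic_int :: "'a padic_int \<Rightarrow> 'a padic_int"
  is "\<lambda>x n. (- x n) mod int CARD('a) ^ n"
  by (simp only: mod_power_Suc_mod atLeastLessThan_iff prime_card_power_pos
      pos_mod_sign pos_mod_bound) (metis mod_minus_eq)

lift_definition minus_padic_int :: "'a padic_int \<Rightarrow> 'a padic_int \<Rightarrow> 'a padic_int"
  is "\<lambda>x y n. (x n - y n) mod int CARD('a) ^ n"
  by (simp only: mod_power_Suc_mod atLeastLessThan_iff prime_card_power_pos
      pos_mod_sign pos_mod_bound) (metis mod_diff_eq)

lift_definition times_padic_int :: "'a padic_int \<Rightarrow> 'a padic_int \<Rightarrow> 'a padic_int"
  is "\<lambda>x y n. (x n * y n) mod int CARD('a) ^ n"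
  by (simp only: mod_power_Suc_mod atLeastLessThan_iff prime_card_power_pos
      pos_mod_sign pos_mod_bound) (metis mod_mult_eq)

instance
proof
  fix a b c :: "'a padic_int"
  show "a + b + c = a + (b + c)"
    by transfer (auto simp: fun_eq_iff mod_simps ac_simps)
  show "a + b = b + a"
    by transfer (auto simp: fun_eq_iff ac_simps)
  show "0 + a = a"
    by transfer (auto simp: fun_eq_iff)
  show "- a + a = 0"
    by transfer (auto simp: fun_eq_iff mod_simps)
  show "a - b = a + - b"
    by transfer (auto simp: fun_eq_iff mod_simps)
  show "a * b * c = a * (b * c)"
    by transfer (auto simp: fun_eq_iff mod_simps ac_simps)
  show "a * b = b * a"
    by transfer (auto simp: fun_eq_iff ac_simps)
  show "1 * a = a"
    by transfer (auto simp: fun_eq_iff mod_simps)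
  show "(a + b) * c = a * c + b * c"
    by transfer (auto simp: fun_eq_iff mod_simps algebra_simps)
  show "(0::'a padic_int) \<noteq> 1"
  proof (transfer, rule notI)
    assume "(\<lambda>_. 0) = (\<lambda>n. 1 mod int CARD('a) ^ n)"
    from fun_cong[OF this, of 1] have "1 mod int CARD('a) = 0" by simp
    moreover have "int CARD('a) > 1"
      using prime_gt_1_nat[OF prime_card[where 'a = 'a]] by linarith
    ultimately show False by simp
  qed
qed

end

lemma padic_seq_mod:
  assumes "\<forall>n. x n \<in> {0..<q ^ n} \<and> x (Suc n) mod (q::int) ^ n = x n"
  shows "x (i + k) mod q ^ i = x i"
proof (induction k)
  case 0
  show ?case using assms by simp
next
  case (Suc k)
  have "x (i + Suc k) mod q ^ i = (x (Suc (i + k)) mod q ^ (i + k)) mod q ^ i"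
    by (simp add: mod_mod_cancel le_imp_power_dvd)
  also have "\<dots> = x i" using assms Suc by simp
  finally show ?case .
qed

instance padic_int :: (prime_card) idom
proof
  fix a b :: "'a padic_int"
  assume "a \<noteq> 0" "b \<noteq> 0"
  then show "a * b \<noteq> 0"
  proof transfer
    fix a b :: "nat \<Rightarrow> int"
    let ?p = "int CARD('a)"
    assume A: "\<forall>n. a n \<in> {0..<?p ^ n} \<and> a (Suc n) mod ?p ^ n = a n"
      and B: "\<forall>n. b n \<in> {0..<?p ^ n} \<and> b (Suc n) mod ?p ^ n = b n"
      and "a \<noteq> (\<lambda>_. 0)" "b \<noteq> (\<lambda>_. 0)"
    then obtain i j where i: "a i \<noteq> 0" and j: "b j \<noteq> 0" by blast
    have p: "prime ?p" using prime_card[where 'a = 'a] by simp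
    let ?x = "a (i + j)" and ?y = "b (i + j)"
    have x: "\<not> ?p ^ i dvd ?x"
      using padic_seq_mod[OF A, of i j] i by (auto simp: dvd_eq_mod_eq_0)
    have y: "\<not> ?p ^ j dvd ?y"
      using padic_seq_mod[OF B, of j i] j by (auto simp: dvd_eq_mod_eq_0 add.commute)
    have nz: "?x \<noteq> 0" "?y \<noteq> 0" using x y by auto
    have "multiplicity ?p ?x < i" "multiplicity ?p ?y < j"
      using x y by (meson multiplicity_dvd' not_le)+
    then have "multiplicity ?p (?x * ?y) < i + j"
      using p nz by (simp add: prime_elem_multiplicity_mult_distrib)
    then have "\<not> ?p ^ (i + j) dvd ?x * ?y"
      using p nz by (subst power_dvd_iff_le_multiplicity) auto
    then have "(?x * ?y) mod ?p ^ (i + j) \<noteq> 0"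
      by (simp add: dvd_eq_mod_eq_0)
    then show "(\<lambda>n. a n * b n mod ?p ^ n) \<noteq> (\<lambda>_. 0)"
      by (metis (no_types, lifting))
  qed
qed

type_synonym 'p padic = "'p padic_int fract"

type_synonym 'p padic_mat = "'p padic ^ 2 ^ 2"

definition padic_integers :: "'p::prime_card padic set" where
  "padic_integers = range to_fract"

text \<open>Unspecified at 0.\<close>

definition padic_ord :: "'p::prime_card padic \<Rightarrow> int" where
  "padic_ord x = (THE k. \<exists>u :: 'p padic_int. u dvd 1 \<and> x = of_nat CARD('p) powi k * to_fract u)"

text \<open>Only meaningful for nonzero arguments.\<close>

definition hilbert_symbol :: "'a::field \<Rightarrow> 'a \<Rightarrow> int" where
  "hilbert_symbol a b =
     (if \<exists>x y z. (x, y, z) \<noteq> (0, 0, 0) \<and> z\<^sup>2 = a * x\<^sup>2 + b * y\<^sup>2 then 1 else - 1)"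

definition mat22 :: "'a \<Rightarrow> 'a \<Rightarrow> 'a \<Rightarrow> 'a \<Rightarrow> 'a::zero ^ 2 ^ 2" where
  "mat22 a b c d = vector [vector [a, b], vector [c, d]]"

definition SL2_Qp :: "'p::prime_card padic_mat set" where
  "SL2_Qp = {g. det g = 1}"

definition SL2_Zp :: "'p::prime_card padic_mat set" where
  "SL2_Zp = {g \<in> SL2_Qp. \<forall>i j. g $ i $ j \<in> padic_integers}"

definition K0 :: "nat \<Rightarrow> 'p::prime_card padic_mat set" where
  "K0 n = {g \<in> SL2_Zp. g $ 2 $ 1 \<in> (\<lambda>x. of_nat CARD('p) ^ n * x) ` padic_integers}"

definition y_mat :: "'a::field \<Rightarrow> 'a ^ 2 ^ 2" where
  "y_mat s = mat22 1 0 s 1"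

definition w_mat :: "'a::field \<Rightarrow> 'a ^ 2 ^ 2" where
  "w_mat t = mat22 0 t (- inverse t) 0"

definition tau :: "'a::field ^ 2 ^ 2 \<Rightarrow> 'a" where
  "tau A = (if A $ 2 $ 1 \<noteq> 0 then A $ 2 $ 1 else A $ 2 $ 2)"

definition s_sign :: "'p::prime_card padic_mat \<Rightarrow> int" where
  "s_sign g =
     (if g $ 2 $ 1 * g $ 2 $ 2 \<noteq> 0 \<and> odd (padic_ord (g $ 2 $ 1))
      then hilbert_symbol (g $ 2 $ 1) (g $ 2 $ 2) else 1)"

definition sigma0 :: "'a::field ^ 2 ^ 2 \<Rightarrow> 'a ^ 2 ^ 2 \<Rightarrow> int" where
  "sigma0 g h = hilbert_symbol (tau (g ** h) * tau g) (tau (g ** h) * tau h)"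

definition cocycle :: "'p::prime_card padic_mat \<Rightarrow> 'p padic_mat \<Rightarrow> int" where
  "cocycle g h = sigma0 g h * s_sign g * s_sign h * s_sign (g ** h)"

definition metaplectic :: "('p::prime_card padic_mat \<times> int) monoid" where
  "metaplectic =
     \<lparr>carrier = SL2_Qp \<times> {1, - 1},
      mult = (\<lambda>(g, e1) (h, e2). (g ** h, e1 * e2 * cocycle g h)),
      one = (mat 1, 1)\<rparr>"

definition full_preimage ::
  "'p::prime_card padic_mat set \<Rightarrow> ('p padic_mat \<times> int) set" where
  "full_preimage S = {x \<in> carrier metaplectic. fst x \<in> S}"

definition double_coset :: "('a, 'b) monoid_scheme \<Rightarrow> 'a set \<Rightarrow> 'a set \<Rightarrow> 'a \<Rightarrow> 'a set" where
  "double_coset G H L x = (H #>\<^bsub>G\<^esub> x) <#>\<^bsub>G\<^esub> L"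

text \<open>
  Using a list rather than a set makes the pairwise inequivalence a statement about the
  family as it is listed.
\<close>

definition double_coset_representatives ::
  "('a, 'b) monoid_scheme \<Rightarrow> 'a set \<Rightarrow> 'a set \<Rightarrow> 'a set \<Rightarrow> 'a list \<Rightarrow> bool" where
  "double_coset_representatives G H S L xs \<longleftrightarrow>
     set xs \<subseteq> S \<and>
     distinct (map (double_coset G H L) xs) \<and>
     set (map (double_coset G H L) xs) = double_coset G H L ` S"

end

theory Submission
  imports Defs "HOL-Number_Theory.Euler_Criterion"
begin

text \<open>
  The full preimages contain the kernel of the cover, so the cocycle plays no role and the problem
  is to classify \<open>K\<^sub>n g K\<^sub>n\<close> for \<open>g\<close> in \<open>SL\<^sub>2(\<int>\<^sub>p)\<close>. Let \<open>c, d\<close> be the bottom row of \<open>g\<close>.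
  The order of \<open>c\<close>, truncated at \<open>n\<close>, is an invariant; when it is \<open>r\<close> with \<open>1 \<le> r < n\<close>, so is the
  class of \<open>c d / p\<^sup>r\<close> modulo \<open>p\<close> and up to squares. Conversely, multiplying by upper triangular
  matrices brings \<open>g\<close> to \<open>y(s p\<^sup>r)\<close> as soon as \<open>s a p\<^sup>r / c\<close> is a square modulo \<open>p\<^sup>r\<close>, where \<open>a\<close> is
  the top left entry; by Hensel lifting it suffices that it is one modulo \<open>p\<close>, which holds for
  \<open>s = 1\<close> or for \<open>s = \<lambda>\<close>.
\<close>

section \<open>Arithmetic of p-adic integers\<close>

abbreviation uniformizer :: "'p::prime_card padic_int" where
  "uniformizer \<equiv> of_nat CARD('p)"

lemma Rep_padic_int_bounds:
  "0 \<le> Rep_padic_int (x :: 'p::prime_card padic_int) n"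
  "Rep_padic_int x n < int CARD('p) ^ n"
  using Rep_padic_int[of x] by auto

lemma Rep_padic_int_Suc_mod:
  "Rep_padic_int (x :: 'p::prime_card padic_int) (Suc n) mod int CARD('p) ^ n = Rep_padic_int x n"
  using Rep_padic_int[of x] by auto

lemma padic_int_eqI:
  "(\<And>n. Rep_padic_int x n = Rep_padic_int y n) \<Longrightarrow> x = y"
  by (metis Rep_padic_int_inject ext)

lemma Rep_padic_int_of_nat:
  "Rep_padic_int (of_nat k :: 'p::prime_card padic_int) n = int k mod int CARD('p) ^ n"
  by (induction k)
    (simp_all add: zero_padic_int.rep_eq one_padic_int.rep_eq plus_padic_int.rep_eq mod_simps)

text \<open>The quotient by p is the sequence shifted by one level: once the residue modulo p
  vanishes, all later residues are multiples of p, and dividing the one at level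
  \<open>Suc n\<close> by p gives the residue of the quotient at level \<open>n\<close>.\<close>

lemma uniformizer_dvd_iff:
  "uniformizer dvd x \<longleftrightarrow> Rep_padic_int (x :: 'p::prime_card padic_int) 1 = 0"
proof
  assume "uniformizer dvd x"
  then obtain y where "x = uniformizer * y" by blast
  then show "Rep_padic_int x 1 = 0"
    by (simp add: times_padic_int.rep_eq Rep_padic_int_of_nat)
next
  assume x1: "Rep_padic_int x 1 = 0"
  let ?p = "int CARD('p)"
  define y where "y n = Rep_padic_int x (Suc n) div ?p" for n
  have p0: "?p > 0" by simp
  have dvd: "?p dvd Rep_padic_int x (Suc n)" for n
  proof -
    have "Rep_padic_int x (1 + n) mod ?p ^ 1 = Rep_padic_int x 1"
      by (rule padic_seq_mod) (use Rep_padic_int[of x] in auto)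
    then show ?thesis using x1 by (simp add: dvd_eq_mod_eq_0)
  qed
  have py: "?p * y n = Rep_padic_int x (Suc n)" for n
    unfolding y_def using dvd by simp
  have comp: "y n \<in> {0..<?p ^ n} \<and> y (Suc n) mod ?p ^ n = y n" for n
  proof -
    have "?p * y n < ?p * ?p ^ n" "0 \<le> ?p * y n"
      using Rep_padic_int_bounds[of x "Suc n"] by (simp_all add: py)
    then have "0 \<le> y n" "y n < ?p ^ n"
      using p0 by (simp_all only: zero_le_mult_iff mult_less_cancel_left_pos) auto
    moreover have "?p * (y (Suc n) mod ?p ^ n) = ?p * y n"
      using Rep_padic_int_Suc_mod[of x "Suc n"] by (simp add: mult_mod_right py)
    ultimately show ?thesis using p0 by simp
  qed
  define z :: "'p padic_int" where "z = Abs_padic_int y"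
  have z: "Rep_padic_int z = y"
    unfolding z_def by (rule Abs_padic_int_inverse) (use comp in auto)
  have "x = uniformizer * z"
  proof (rule padic_int_eqI)
    fix n
    show "Rep_padic_int x n = Rep_padic_int (uniformizer * z) n"
      using Rep_padic_int_Suc_mod[of x n]
      by (simp add: times_padic_int.rep_eq Rep_padic_int_of_nat z mod_simps py)
  qed
  then show "uniformizer dvd x" by simp
qed

lemma not_uniformizer_dvd_1: "\<not> uniformizer dvd (1 :: 'p::prime_card padic_int)"
  using prime_gt_1_int[OF prime_card_int[where 'a = 'p]]
  by (simp add: uniformizer_dvd_iff one_padic_int.rep_eq)

lemma uniformizer_nonzero: "(uniformizer :: 'p::prime_card padic_int) \<noteq> 0"
proof
  assume "(uniformizer :: 'p padic_int) = 0"
  \<comment> \<open>Level 2 is the first at which p has a nonzero residue.\<close>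
  then have "Rep_padic_int (uniformizer :: 'p padic_int) 2 = 0"
    by (simp add: zero_padic_int.rep_eq)
  then have "int CARD('p) ^ 2 dvd int CARD('p)"
    by (simp only: Rep_padic_int_of_nat dvd_eq_mod_eq_0)
  then have "int CARD('p) ^ 2 \<le> int CARD('p)" by (rule zdvd_imp_le) simp
  then show False
    using prime_gt_1_int[OF prime_card_int[where 'a = 'p]] by (simp add: power2_eq_square)
qed

text \<open>An element with nonzero residue modulo p is invertible at each finite level, and these
  inverses form a compatible family because an inverse modulo a power of p is unique.\<close>

lemma padic_unit_iff:
  "x dvd 1 \<longleftrightarrow> \<not> uniformizer dvd (x :: 'p::prime_card padic_int)"
proof
  assume "x dvd 1"
  then show "\<not> uniformizer dvd x" using not_uniformizer_dvd_1 dvd_trans by blast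
next
  assume x: "\<not> uniformizer dvd x"
  let ?p = "int CARD('p)"
  have cop: "coprime (Rep_padic_int x n) (?p ^ n)" for n
  proof (cases n)
    case (Suc m)
    have "Rep_padic_int x (1 + m) mod ?p ^ 1 = Rep_padic_int x 1"
      by (rule padic_seq_mod) (use Rep_padic_int[of x] in auto)
    then have "\<not> ?p dvd Rep_padic_int x n"
      using x Suc by (simp add: uniformizer_dvd_iff dvd_eq_mod_eq_0)
    then show ?thesis
      using prime_imp_coprime[OF prime_card_int[where 'a = 'p]] by (simp add: coprime_commute)
  qed simp
  then have "\<exists>z. [Rep_padic_int x n * z = 1] (mod ?p ^ n)" for n
    by (rule cong_solve_coprime_int)
  then obtain z where z: "[Rep_padic_int x n * z n = 1] (mod ?p ^ n)" for n by metis
  define y where "y n = z n mod ?p ^ n" for n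
  have xy: "[Rep_padic_int x n * y n = 1] (mod ?p ^ n)" for n
    using z[of n] unfolding y_def cong_def by (simp add: mod_simps)
  \<comment> \<open>Both \<open>y (Suc n)\<close> and \<open>y n\<close> invert the level
    \<open>n\<close> residue of \<open>x\<close>, so cancelling that residue identifies
    them.\<close>
  have "[Rep_padic_int x n * y (Suc n) = Rep_padic_int x n * y n] (mod ?p ^ n)" for n
  proof -
    have "[Rep_padic_int x (Suc n) * y (Suc n) = 1] (mod ?p ^ n)"
      using xy[of "Suc n"] by (rule cong_dvd_modulus) simp
    moreover have "[Rep_padic_int x (Suc n) = Rep_padic_int x n] (mod ?p ^ n)"
      using Rep_padic_int_Suc_mod[of x n] by (metis cong_def mod_mod_trivial)
    ultimately show ?thesis
      using xy[of n] by (meson cong_scalar_right cong_sym cong_trans)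
  qed
  then have "[y (Suc n) = y n] (mod ?p ^ n)" for n
    using cop[of n] cong_mult_lcancel by blast
  then have comp: "y n \<in> {0..<?p ^ n} \<and> y (Suc n) mod ?p ^ n = y n" for n
    by (simp add: y_def cong_def)
  define u :: "'p padic_int" where "u = Abs_padic_int y"
  have u: "Rep_padic_int u = y"
    unfolding u_def by (rule Abs_padic_int_inverse) (use comp in auto)
  have "x * u = 1"
    by (rule padic_int_eqI)
      (use xy in \<open>simp add: times_padic_int.rep_eq one_padic_int.rep_eq u cong_def\<close>)
  then show "x dvd 1" by (metis dvd_triv_left)
qed

text \<open>Stands in for the valuation: p is split off until a unit remains or \<open>n\<close>
  factors have been found. The cut-off lets zero be handled like any other element and matches the
  level of \<open>K0 n\<close>.\<close>

lemma padic_truncated_factorization: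
  fixes x :: "'p::prime_card padic_int"
  obtains "uniformizer ^ n dvd x" | r u where "r < n" "u dvd 1" "x = uniformizer ^ r * u"
proof -
  have "uniformizer ^ n dvd x \<or> (\<exists>r u. r < n \<and> u dvd 1 \<and> x = uniformizer ^ r * u)"
  proof (induction n)
    case (Suc n)
    show ?case
    proof (cases "uniformizer ^ n dvd x")
      case True
      then obtain u where u: "x = uniformizer ^ n * u" by blast
      show ?thesis
      proof (cases "u dvd 1")
        case True
        then show ?thesis using u by blast
      next
        case False
        then have "uniformizer ^ n * uniformizer dvd x"
          unfolding u padic_unit_iff by (intro mult_dvd_mono) auto
        then show ?thesis by (simp add: mult.commute)
      qed
    next
      case False
      then show ?thesis using Suc less_SucI by blast
    qed
  qed simp
  then show ?thesis using that by blast
qed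

section \<open>Hensel lifting of square roots\<close>

text \<open>Newton iteration for square roots, which works because 2 and every approximate root are
  units. A root modulo each power of p is enough later, so no limit is formed.\<close>

lemma padic_square_mod_power:
  fixes v a :: "'p::prime_card padic_int"
  assumes "odd CARD('p)" and v: "v dvd 1" and a: "uniformizer dvd v - a\<^sup>2"
  shows "\<exists>b. b dvd 1 \<and> uniformizer ^ r dvd v - b\<^sup>2"
proof -
  have two: "(2 :: 'p padic_int) dvd 1"
  proof -
    have "\<not> int CARD('p) dvd 2"
      using prime_card_int[where 'a = 'p] assms(1)
      by (metis even_of_nat primes_dvd_imp_eq two_is_prime_nat of_nat_numeral
          int_dvd_int_iff prime_card)
    then show ?thesis
      using Rep_padic_int_of_nat[of 2 1, where 'p = 'p]
      by (simp add: padic_unit_iff uniformizer_dvd_iff dvd_eq_mod_eq_0)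
  qed
  have unit: "b dvd 1" if "uniformizer dvd v - b\<^sup>2" for b
  proof (rule ccontr)
    assume "\<not> b dvd 1"
    then have "uniformizer dvd b\<^sup>2" by (simp add: padic_unit_iff power2_eq_square)
    then have "uniformizer dvd (v - b\<^sup>2) + b\<^sup>2" using that by (rule dvd_add[rotated])
    then show False using v by (simp add: padic_unit_iff)
  qed
  \<comment> \<open>The exponent is kept positive, so that the hypothesis modulo p starts the
    induction and every approximate root is a unit.\<close>
  have "\<exists>b. uniformizer ^ Suc r dvd v - b\<^sup>2"
  proof (induction r)
    case 0
    show ?case using a by auto
  next
    case (Suc r)
    then obtain b where b: "uniformizer ^ Suc r dvd v - b\<^sup>2" by blast
    then obtain m where m: "v - b\<^sup>2 = uniformizer ^ Suc r * m" by blast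
    have "b dvd 1" using b by (intro unit) (metis dvd_mult_left power_Suc)
    with two have "2 * b dvd 1" by (metis mult_dvd_mono mult_1)
    then obtain h where h: "1 = 2 * b * h" by blast
    \<comment> \<open>\<open>e\<close> is the Newton correction
      \<open>(v - b\<^sup>2) / (2 * b)\<close>, with \<open>h\<close> the inverse of
      \<open>2 * b\<close>. The linear terms cancel and the new error is
      \<open>- (e\<^sup>2)\<close>.\<close>
    define e where "e = uniformizer ^ Suc r * m * h"
    have "v - (b + e)\<^sup>2 = (v - b\<^sup>2) - (2 * b * h) * uniformizer ^ Suc r * m - e\<^sup>2"
      unfolding e_def by (simp add: power2_eq_square algebra_simps)
    also have "\<dots> = - (e\<^sup>2)" using m h by simp
    also have "uniformizer ^ Suc (Suc r) dvd \<dots>"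
    proof -
      have "e\<^sup>2 = uniformizer ^ Suc (Suc r) * (uniformizer ^ r * (m * h)\<^sup>2)"
        unfolding e_def by (simp add: power2_eq_square algebra_simps)
      then show ?thesis by simp
    qed
    finally show ?case by blast
  qed
  then obtain b where b: "uniformizer ^ Suc r dvd v - b\<^sup>2" by blast
  then have "b dvd 1" by (intro unit) (metis dvd_mult_left power_Suc)
  moreover have "uniformizer ^ r dvd v - b\<^sup>2" using b by (metis dvd_mult_right power_Suc)
  ultimately show ?thesis by blast
qed

section \<open>Squares modulo p\<close>

lemma uniformizer_dvd_diff_iff:
  "uniformizer dvd x - y \<longleftrightarrow>
     [Rep_padic_int y 1 = Rep_padic_int (x :: 'p::prime_card padic_int) 1] (mod int CARD('p))"
  by (simp add: uniformizer_dvd_iff minus_padic_int.rep_eq cong_iff_dvd_diff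
      dvd_eq_mod_eq_0[symmetric] dvd_diff_commute)

lemma Rep_padic_int_square:
  "[Rep_padic_int ((y :: 'p::prime_card padic_int)\<^sup>2) 1 = (Rep_padic_int y 1)\<^sup>2] (mod int CARD('p))"
  by (simp add: power2_eq_square times_padic_int.rep_eq cong_def)

text \<open>Connects squares modulo p among p-adic integers with quadratic residues of integers, so
  that Euler's criterion applies.\<close>

lemma QuadRes_Rep_padic_int_iff:
  fixes x :: "'p::prime_card padic_int"
  shows "QuadRes (int CARD('p)) (Rep_padic_int x 1) \<longleftrightarrow> (\<exists>y. uniformizer dvd x - y\<^sup>2)"
proof
  let ?p = "int CARD('p)"
  assume "QuadRes ?p (Rep_padic_int x 1)"
  then obtain k where k: "[k\<^sup>2 = Rep_padic_int x 1] (mod ?p)" by (auto simp: QuadRes_def)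
  define y :: "'p padic_int" where "y = of_nat (nat (k mod ?p))"
  have "Rep_padic_int y 1 = k mod ?p"
    unfolding y_def Rep_padic_int_of_nat by simp
  then have "[Rep_padic_int y 1 = k] (mod ?p)" by (simp add: cong_def)
  then have "[(Rep_padic_int y 1)\<^sup>2 = k\<^sup>2] (mod ?p)" by (rule cong_pow)
  then have "uniformizer dvd x - y\<^sup>2"
    unfolding uniformizer_dvd_diff_iff using k Rep_padic_int_square[of y] by (meson cong_trans)
  then show "\<exists>y. uniformizer dvd x - y\<^sup>2" by blast
next
  assume "\<exists>y. uniformizer dvd x - y\<^sup>2"
  then obtain y where "uniformizer dvd x - y\<^sup>2" by blast
  then have "[(Rep_padic_int y 1)\<^sup>2 = Rep_padic_int x 1] (mod int CARD('p))"
    unfolding uniformizer_dvd_diff_iff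
    using Rep_padic_int_square[of y] by (meson cong_sym cong_trans)
  then show "QuadRes (int CARD('p)) (Rep_padic_int x 1)" unfolding QuadRes_def by blast
qed

text \<open>Euler's criterion makes the Legendre symbol multiplicative modulo p, so the symbols -1
  of two nonsquares multiply to 1. This is why the coefficients 1 and \<open>l\<close> suffice in
  the list of representatives.\<close>

lemma padic_nonsquare_mult:
  fixes u l :: "'p::prime_card padic_int"
  assumes "odd CARD('p)" "l dvd 1" "u dvd 1"
    and "\<nexists>x. uniformizer dvd l - x\<^sup>2" and "\<nexists>x. uniformizer dvd u - x\<^sup>2"
  shows "\<exists>x. uniformizer dvd l * u - x\<^sup>2"
proof -
  let ?p = "int CARD('p)"
  have p: "prime CARD('p)" "2 < CARD('p)"
    using prime_card[where 'a = 'p] assms(1) prime_ge_2_nat[of "CARD('p)"]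
    by (auto simp: le_less)
  let ?l = "Rep_padic_int l 1" and ?u = "Rep_padic_int u 1"
  have euler: "[Legendre a ?p = a ^ ((CARD('p) - 1) div 2)] (mod ?p)" for a
    using euler_criterion p by simp
  have "\<not> QuadRes ?p ?l" "\<not> QuadRes ?p ?u"
    using assms(4,5) by (simp_all only: QuadRes_Rep_padic_int_iff not_False_eq_True)
  moreover have "?l mod ?p = ?l" "?u mod ?p = ?u"
    using Rep_padic_int_bounds[of l 1] Rep_padic_int_bounds[of u 1] by simp_all
  moreover have "?l \<noteq> 0" "?u \<noteq> 0"
    using assms(2,3) by (simp_all add: padic_unit_iff uniformizer_dvd_iff)
  ultimately have L: "Legendre ?l ?p = -1" "Legendre ?u ?p = -1"
    by (auto simp: Legendre_def cong_def)
  have "[Legendre (?l * ?u) ?p = Legendre ?l ?p * Legendre ?u ?p] (mod ?p)"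
    using cong_trans[OF euler[of "?l * ?u", unfolded power_mult_distrib]
        cong_sym[OF cong_mult[OF euler[of ?l] euler[of ?u]]]] .
  then have "[Legendre (?l * ?u) ?p = 1] (mod ?p)" unfolding L by simp
  \<comment> \<open>As p exceeds 2, a symbol congruent to 1 can be neither -1 nor 0.\<close>
  moreover have "\<not> [-1 = 1] (mod ?p)" "\<not> [0 = 1] (mod ?p)"
    using p(2) by (auto simp: cong_iff_dvd_diff dest!: zdvd_imp_le)
  ultimately have "QuadRes ?p (?l * ?u)"
    by (auto simp only: Legendre_def split: if_splits)
  then have "QuadRes ?p (Rep_padic_int (l * u) 1)"
    by (simp add: times_padic_int.rep_eq QuadRes_def cong_def)
  then show ?thesis by (simp only: QuadRes_Rep_padic_int_iff)
qed


section \<open>Integral matrices\<close>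

text \<open>Entries are taken in the ring rather than in its fraction field, so that products,
  determinants and divisibility conditions are computed without fractions.\<close>

definition zmat ::
  "'p::prime_card padic_int \<Rightarrow> 'p padic_int \<Rightarrow> 'p padic_int \<Rightarrow> 'p padic_int \<Rightarrow> 'p padic_mat" where
  "zmat a b c d = mat22 (to_fract a) (to_fract b) (to_fract c) (to_fract d)"

lemma mat22_nth [simp]:
  "mat22 a b c d $ 1 $ 1 = a" "mat22 a b c d $ 1 $ 2 = b"
  "mat22 a b c d $ 2 $ 1 = c" "mat22 a b c d $ 2 $ 2 = d"
  by (simp_all add: mat22_def)

lemma mat22_eqI:
  "g $ 1 $ 1 = a \<Longrightarrow> g $ 1 $ 2 = b \<Longrightarrow> g $ 2 $ 1 = c \<Longrightarrow> g $ 2 $ 2 = d \<Longrightarrow> g = mat22 a b c d"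
  by (simp add: vec_eq_iff forall_2)

lemma zmat_eq_iff:
  "zmat a b c d = zmat a' b' c' d' \<longleftrightarrow> a = a' \<and> b = b' \<and> c = c' \<and> d = d'"
  by (auto simp: zmat_def vec_eq_iff forall_2)

lemma zmat_mult:
  "zmat a b c d ** zmat a' b' c' d' =
     zmat (a * a' + b * c') (a * b' + b * d') (c * a' + d * c') (c * b' + d * d')"
  unfolding zmat_def by (rule mat22_eqI) (simp_all add: matrix_matrix_mult_def sum_2)

lemma to_fract_of_nat: "to_fract (of_nat k) = of_nat k"
  by (induction k) simp_all

lemma to_fract_power: "to_fract (x ^ k) = to_fract x ^ k"
  by (induction k) simp_all

lemma zmat_1: "mat 1 = zmat 1 0 0 1"
  unfolding zmat_def by (rule mat22_eqI) (simp_all add: mat_def)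

lemma w_mat_1: "w_mat 1 = zmat 0 1 (- 1) 0"
  by (simp add: w_mat_def zmat_def)

lemma y_mat_to_fract: "y_mat (to_fract s) = zmat 1 0 s 1"
  by (simp add: y_mat_def zmat_def)

lemma det_zmat: "det (zmat a b c d) = to_fract (a * d - b * c)"
  by (simp add: det_2 zmat_def)

lemma zmat_in_SL2_Zp_iff: "zmat a b c d \<in> SL2_Zp \<longleftrightarrow> a * d - b * c = 1"
proof -
  have "det (zmat a b c d) = 1 \<longleftrightarrow> a * d - b * c = 1"
    unfolding det_zmat by (metis to_fract_1 to_fract_eq_iff)
  moreover have "\<forall>i j. zmat a b c d $ i $ j \<in> padic_integers"
    by (simp add: zmat_def forall_2 padic_integers_def)
  ultimately show ?thesis by (simp add: SL2_Zp_def SL2_Qp_def)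
qed

lemma SL2_Zp_cases:
  assumes "g \<in> SL2_Zp"
  obtains a b c d where "g = zmat a b c d" "a * d - b * c = 1"
proof -
  have "\<exists>x. g $ i $ j = to_fract x" for i j
    using assms by (auto simp: SL2_Zp_def padic_integers_def)
  then obtain a b c d where "g $ 1 $ 1 = to_fract a" "g $ 1 $ 2 = to_fract b"
    "g $ 2 $ 1 = to_fract c" "g $ 2 $ 2 = to_fract d"
    by metis
  then have "g = zmat a b c d" unfolding zmat_def by (rule mat22_eqI)
  with assms that show thesis by (simp add: zmat_in_SL2_Zp_iff)
qed

lemma zmat_in_K0_iff:
  "zmat a b c d \<in> K0 n \<longleftrightarrow> a * d - b * c = 1 \<and> uniformizer ^ n dvd c"
proof -
  have "to_fract c = of_nat CARD('a) ^ n * to_fract z \<longleftrightarrow> c = uniformizer ^ n * z" for z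
    by (metis to_fract_eq_iff to_fract_mult to_fract_of_nat to_fract_power)
  then have "to_fract c \<in> (\<lambda>x. of_nat CARD('a) ^ n * x) ` padic_integers \<longleftrightarrow> uniformizer ^ n dvd c"
    by (auto simp: padic_integers_def dvd_def)
  moreover have "zmat a b c d $ 2 $ 1 = to_fract c" by (simp add: zmat_def)
  ultimately show ?thesis by (simp add: K0_def zmat_in_SL2_Zp_iff)
qed

lemma K0_cases:
  assumes "g \<in> K0 n"
  obtains a b c d where "g = zmat a b c d" "a * d - b * c = 1" "uniformizer ^ n dvd c"
proof -
  have "g \<in> SL2_Zp" using assms by (simp add: K0_def)
  then show thesis using assms that by (metis SL2_Zp_cases zmat_in_K0_iff)
qed

lemma one_in_K0: "mat 1 \<in> K0 n"
  by (simp add: zmat_1 zmat_in_K0_iff)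

lemma K0_mult: "g \<in> K0 n \<Longrightarrow> h \<in> K0 n \<Longrightarrow> g ** h \<in> K0 n"
proof (elim K0_cases)
  fix a b c d a' b' c' d'
  assume g: "g = zmat a b c d" "a * d - b * c = 1" "uniformizer ^ n dvd c"
    and h: "h = zmat a' b' c' d'" "a' * d' - b' * c' = 1" "uniformizer ^ n dvd c'"
  have "(a * a' + b * c') * (c * b' + d * d') - (a * b' + b * d') * (c * a' + d * c') =
      (a * d - b * c) * (a' * d' - b' * c')"
    by (simp add: algebra_simps)
  then show "g ** h \<in> K0 n" using g h by (simp add: zmat_mult zmat_in_K0_iff)
qed

lemma K0_inverse:
  assumes "g \<in> K0 n"
  obtains h where "h \<in> K0 n" "g ** h = mat 1" "h ** g = mat 1"
proof -
  from assms obtain a b c d where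
    g: "g = zmat a b c d" "a * d - b * c = 1" "uniformizer ^ n dvd c" by (rule K0_cases)
  \<comment> \<open>The inverse is the adjugate, as the determinant is 1.\<close>
  show thesis
    by (rule that[of "zmat d (- b) (- c) a"])
      (use g in \<open>auto simp: zmat_in_K0_iff zmat_mult zmat_1 zmat_eq_iff algebra_simps\<close>)
qed

section \<open>Double cosets\<close>

definition K0_double_coset :: "nat \<Rightarrow> 'p::prime_card padic_mat \<Rightarrow> 'p padic_mat set" where
  "K0_double_coset n g = {h ** g ** k |h k. h \<in> K0 n \<and> k \<in> K0 n}"

lemma K0_double_coset_refl: "g \<in> K0_double_coset n g"
proof -
  have "g = mat 1 ** g ** mat 1" by simp
  then show ?thesis unfolding K0_double_coset_def using one_in_K0 by blast
qed

lemma K0_double_coset_sym: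
  assumes "x \<in> K0_double_coset n g"
  shows "g \<in> K0_double_coset n x"
proof -
  from assms obtain h k where x: "x = h ** g ** k" and hk: "h \<in> K0 n" "k \<in> K0 n"
    by (auto simp: K0_double_coset_def)
  from hk obtain h' k' where
    h': "h' \<in> K0 n" "h' ** h = mat 1" and k': "k' \<in> K0 n" "k ** k' = mat 1"
    by (metis K0_inverse)
  have "h' ** x ** k' = (h' ** h) ** g ** (k ** k')"
    unfolding x by (simp add: matrix_mul_assoc)
  then have "g = h' ** x ** k'" by (simp add: h' k')
  then show ?thesis using h'(1) k'(1) by (auto simp: K0_double_coset_def)
qed

lemma K0_double_coset_mono:
  assumes "x \<in> K0_double_coset n g"
  shows "K0_double_coset n x \<subseteq> K0_double_coset n g"
proof
  fix y assume "y \<in> K0_double_coset n x"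
  then obtain h k where y: "y = h ** x ** k" and hk: "h \<in> K0 n" "k \<in> K0 n"
    by (auto simp: K0_double_coset_def)
  from assms obtain h' k' where x: "x = h' ** g ** k'" and hk': "h' \<in> K0 n" "k' \<in> K0 n"
    by (auto simp: K0_double_coset_def)
  have "y = (h ** h') ** g ** (k' ** k)"
    unfolding x y by (simp add: matrix_mul_assoc)
  then show "y \<in> K0_double_coset n g"
    unfolding K0_double_coset_def using hk hk' K0_mult by blast
qed

lemma K0_double_coset_eq:
  "x \<in> K0_double_coset n g \<Longrightarrow> K0_double_coset n x = K0_double_coset n g"
  by (meson K0_double_coset_mono K0_double_coset_sym subset_antisym)

lemma cocycle_cases: "cocycle g h \<in> {1, - 1}"
  by (auto simp: cocycle_def sigma0_def s_sign_def hilbert_symbol_def)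

text \<open>
  Both preimages contain the kernel \<open>{1, - 1}\<close> of the cover, so the cocycle only permutes the signs
  and a double coset upstairs is the full preimage of the one downstairs.
\<close>

lemma double_coset_full_preimage_K0:
  fixes e :: int
  assumes "e \<in> {1, - 1}"
  shows "double_coset metaplectic (full_preimage (K0 n)) (full_preimage (K0 n)) (g, e) =
    K0_double_coset n g \<times> {1, - 1}"
proof -
  have mem: "(k, i) \<in> full_preimage (K0 n) \<longleftrightarrow> k \<in> K0 n \<and> i \<in> {1, - 1}"
    for k :: "'a padic_mat" and i :: int
    by (auto simp: full_preimage_def metaplectic_def K0_def SL2_Zp_def)
  have sgn: "i * j \<in> {1, - 1}" if "i \<in> {1, - 1}" "j \<in> {1, - 1}" for i j :: int
    using that by auto
  show ?thesis
  proof (intro subset_antisym subsetI)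
    fix x assume "x \<in> double_coset metaplectic (full_preimage (K0 n)) (full_preimage (K0 n)) (g, e)"
    then obtain h i k j where hk: "(h, i) \<in> full_preimage (K0 n)" "(k, j) \<in> full_preimage (K0 n)"
      and x: "x = (h ** g ** k, i * e * cocycle h g * j * cocycle (h ** g) k)"
      by (auto simp: double_coset_def r_coset_def set_mult_def metaplectic_def)
    have "i * e * cocycle h g * j * cocycle (h ** g) k \<in> {1, - 1}"
      using hk assms by (intro sgn cocycle_cases) (auto simp: mem)
    then show "x \<in> K0_double_coset n g \<times> {1, - 1}"
      using hk unfolding x mem K0_double_coset_def by blast
  next
    fix x assume "x \<in> K0_double_coset n g \<times> {1, - 1 :: int}"
    then obtain h k i where hk: "h \<in> K0 n" "k \<in> K0 n" and i: "i \<in> {1, - 1}"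
      and x: "x = (h ** g ** k, i)"
      by (auto simp: K0_double_coset_def)
    \<comment> \<open>\<open>c\<close> is the total sign contributed by \<open>e\<close> and the two
      cocycle values. Putting it into the left factor makes it occur twice, and
      \<open>c * c = 1\<close>.\<close>
    define c where "c = e * cocycle h g * cocycle (h ** g) k"
    have c: "c \<in> {1, - 1}" unfolding c_def using assms by (intro sgn cocycle_cases)
    have "(i * c) * e * cocycle h g * 1 * cocycle (h ** g) k = i * (c * c)"
      by (simp add: c_def algebra_simps)
    also have "\<dots> = i" using c by auto
    finally have "x = (h, i * c) \<otimes>\<^bsub>metaplectic\<^esub> (g, e) \<otimes>\<^bsub>metaplectic\<^esub> (k, 1)"
      by (simp add: x metaplectic_def)
    moreover have "(h, i * c) \<in> full_preimage (K0 n)" "(k, 1) \<in> full_preimage (K0 n)"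
      using hk i c sgn by (simp_all add: mem)
    ultimately show "x \<in> double_coset metaplectic (full_preimage (K0 n)) (full_preimage (K0 n)) (g, e)"
      unfolding double_coset_def r_coset_def set_mult_def by blast
  qed
qed

section \<open>Invariants of a double coset\<close>

text \<open>Modulo \<open>uniformizer ^ n\<close> both outer factors are upper triangular, so the
  lower left entry is only multiplied by the diagonal entries \<open>d1\<close> and
  \<open>a2\<close>. By the symmetry of double cosets its order, truncated at \<open>n\<close>, is
  then an invariant.\<close>

lemma K0_double_coset_lower_left_dvd:
  assumes "zmat a' b' c' d' \<in> K0_double_coset n (zmat a b c d)" "j \<le> n" "uniformizer ^ j dvd c"
  shows "uniformizer ^ j dvd c'"
proof -
  from assms(1) obtain a1 b1 c1 d1 a2 b2 c2 d2 where
    "uniformizer ^ n dvd c1" "uniformizer ^ n dvd c2"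
    and c': "c' = (c1 * a + d1 * c) * a2 + (c1 * b + d1 * d) * c2"
    unfolding K0_double_coset_def by (fastforce simp: zmat_mult zmat_eq_iff elim!: K0_cases)
  then have "uniformizer ^ j dvd c1" "uniformizer ^ j dvd c2"
    using assms(2) by (meson dvd_trans le_imp_power_dvd)+
  then show ?thesis unfolding c' using assms(3) by simp
qed

text \<open>Modulo \<open>uniformizer ^ Suc r\<close> the outer factors are upper triangular and
  \<open>c\<^sup>2\<close> vanishes, since \<open>2 * r \<ge> r + 1\<close>. What remains of
  \<open>c' * d'\<close> is \<open>d1\<^sup>2 * c * d * (a2 * d2)\<close> with
  \<open>a2 * d2\<close> congruent to 1, so \<open>t = d1\<close> works.\<close>

lemma K0_double_coset_square_class:
  fixes a b c d :: "'p::prime_card padic_int"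
  assumes "zmat a' b' c' d' \<in> K0_double_coset n (zmat a b c d)"
    and "1 \<le> r" "r < n" "uniformizer ^ r dvd c"
  shows "\<exists>t. uniformizer ^ Suc r dvd c' * d' - c * d * t\<^sup>2"
proof -
  from assms(1) obtain a1 b1 c1 d1 a2 b2 c2 d2 where
    c12: "uniformizer ^ n dvd c1" "uniformizer ^ n dvd c2" and det: "a2 * d2 - b2 * c2 = 1"
    and c': "c' = (c1 * a + d1 * c) * a2 + (c1 * b + d1 * d) * c2"
    and d': "d' = (c1 * a + d1 * c) * b2 + (c1 * b + d1 * d) * d2"
    unfolding K0_double_coset_def by (fastforce simp: zmat_mult zmat_eq_iff elim!: K0_cases)
  define P where "P = (uniformizer :: 'p padic_int) ^ Suc r"
  have "P dvd c1" "P dvd c2"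
    unfolding P_def using c12 assms(3) by (meson dvd_trans le_imp_power_dvd Suc_leI)+
  moreover have "P dvd c\<^sup>2"
  proof -
    have "P dvd uniformizer ^ (r * 2)" using assms(2) unfolding P_def by (intro le_imp_power_dvd) simp
    also have "\<dots> dvd c\<^sup>2" using assms(4) by (simp add: power_mult dvd_power_same)
    finally show ?thesis .
  qed
  ultimately obtain f1 f2 h where f: "c1 = P * f1" "c2 = P * f2" "c\<^sup>2 = P * h"
    by (elim dvdE) blast
  \<comment> \<open>The cofactor gathers the terms of the expanded product that carry a factor
    \<open>c1\<close>, \<open>c2\<close> or \<open>c\<^sup>2\<close>, after \<open>a2 * d2\<close>
    is replaced by \<open>1 + b2 * c2\<close>.\<close>
  have "c' * d' - c * d * d1\<^sup>2 =
      P * (d1\<^sup>2 * a2 * b2 * h + d1\<^sup>2 * c * d * b2 * f2 +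
        (f1 * a * a2 + (c1 * b + d1 * d) * f2) * d' + d1 * a2 * c * f1 * (a * b2 + b * d2))"
    (is "_ = P * ?q")
  proof -
    have "c' * d' - c * d * d1\<^sup>2 = P * ?q + d1\<^sup>2 * a2 * b2 * (c\<^sup>2 - P * h) +
        d1\<^sup>2 * c * d * (a2 * d2 - b2 * c2 - 1)"
      unfolding c' d' f(1,2) by (simp add: algebra_simps power2_eq_square)
    then show ?thesis using det f(3) by simp
  qed
  then show ?thesis unfolding P_def by (metis dvd_triv_left)
qed

text \<open>Reads the exponent \<open>r\<close> off the lower left entry of a representative. If
  \<open>j\<close> exceeded \<open>r\<close>, cancelling \<open>uniformizer ^ r\<close> would leave
  the unit \<open>u\<close> divisible by p.\<close>

lemma uniformizer_power_dvd_iff: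
  fixes u :: "'p::prime_card padic_int"
  assumes "u dvd 1"
  shows "uniformizer ^ j dvd u * uniformizer ^ r \<longleftrightarrow> j \<le> r"
proof
  assume dvd: "uniformizer ^ j dvd u * uniformizer ^ r"
  show "j \<le> r"
  proof (rule ccontr)
    assume "\<not> j \<le> r"
    then have "uniformizer ^ Suc r dvd u * uniformizer ^ r"
      using dvd by (meson dvd_trans le_imp_power_dvd not_less_eq_eq)
    then have "uniformizer dvd u" using uniformizer_nonzero[where 'p = 'p] by (simp add: mult.commute)
    then show False using assms padic_unit_iff by blast
  qed
qed (simp add: le_imp_power_dvd)

section \<open>Reduction to the representatives\<close>

text \<open>Bruhat decomposition of the big cell: as \<open>c\<close> is a unit, the two upper
  triangular factors around the Weyl element are integral and hence lie in every
  \<open>K0 n\<close>.\<close>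

lemma K0_double_coset_big_cell:
  assumes "a * d - b * c = 1" "c dvd 1"
  shows "zmat a b c d \<in> K0_double_coset n (zmat 0 1 (- 1) 0)"
proof -
  from assms(2) obtain i where i: "1 = c * i" by blast
  have "zmat a b c d = zmat 1 (a * i) 0 1 ** zmat 0 1 (- 1) 0 ** zmat (- c) (- d) 0 (- i)"
  proof -
    have ci: "i * c = 1" using i by (simp add: mult.commute)
    have "a * i * d - i = i * (a * d - b * c) + b * (i * c) - i" by (simp add: algebra_simps)
    then have "a * i * d - i = b" using ci assms(1) by simp
    then show ?thesis using ci by (simp add: zmat_mult zmat_eq_iff)
  qed
  moreover have "zmat 1 (a * i) 0 1 \<in> K0 n" "zmat (- c) (- d) 0 (- i) \<in> K0 n"
    using i by (simp_all add: zmat_in_K0_iff)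
  ultimately show ?thesis unfolding K0_double_coset_def by blast
qed

text \<open>An upper triangular left factor with diagonal \<open>t\<close>, \<open>t'\<close> is
  sought such that removing it, and then the lower unipotent matrix, leaves an upper triangular
  matrix. The lower left entry can be made to vanish once \<open>s * a / u\<close> is congruent to
  \<open>t\<^sup>2\<close> modulo \<open>uniformizer ^ r\<close>, and Hensel lifting supplies such a
  \<open>t\<close>.\<close>

lemma K0_double_coset_lower_unipotent:
  fixes a b c d s u :: "'p::prime_card padic_int"
  assumes odd: "odd CARD('p)" and det: "a * d - b * c = 1"
    and c: "c = uniformizer ^ r * u" and "u dvd 1" "1 \<le> r" "s dvd 1"
    and sq: "uniformizer dvd s * (a * u) - x\<^sup>2"
  shows "zmat a b c d \<in> K0_double_coset n (zmat 1 0 (s * uniformizer ^ r) 1)"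
proof -
  obtain i where i: "u * i = 1" using assms(4) by (metis dvdE)
  have "uniformizer dvd c" unfolding c using assms(5) by (simp add: dvd_power)
  have a: "a dvd 1"
  proof (rule ccontr)
    assume "\<not> a dvd 1"
    then have "uniformizer dvd a * d - b * c"
      using \<open>uniformizer dvd c\<close> by (simp add: padic_unit_iff)
    then show False using det not_uniformizer_dvd_1[where 'p = 'p] by simp
  qed
  have "i dvd 1" using i by (metis dvd_triv_right)
  with \<open>s dvd 1\<close> a have unit: "s * a * i dvd 1"
    using mult_dvd_mono[of "s * a" 1 i 1] mult_dvd_mono[of s 1 a 1] by simp
  \<comment> \<open>Multiplication by the square of \<open>i\<close>, the inverse of
    \<open>u\<close>, turns \<open>s * (a * u)\<close> into \<open>s * a / u\<close>.\<close>
  have "i\<^sup>2 * (s * (a * u) - x\<^sup>2) = s * a * i * (u * i) - (x * i)\<^sup>2"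
    by (simp add: algebra_simps power2_eq_square)
  then have "s * a * i - (x * i)\<^sup>2 = i\<^sup>2 * (s * (a * u) - x\<^sup>2)" using i by simp
  then have "uniformizer dvd s * a * i - (x * i)\<^sup>2" using sq by simp
  from padic_square_mod_power[OF odd unit this, of r] obtain t where
    t: "t dvd 1" "uniformizer ^ r dvd s * a * i - t\<^sup>2" by blast
  define q where "q = (uniformizer :: 'p padic_int) ^ r"
  obtain m where m: "s * a * i - t\<^sup>2 = q * m" using t(2) unfolding q_def by blast
  obtain t' where t': "t * t' = 1" using t(1) by (metis dvdE)
  obtain s' where s': "s * s' = 1" using \<open>s dvd 1\<close> by (metis dvdE)
  have "s * a = s * a * (u * i)" using i by simp
  also have "\<dots> = u * (s * a * i)" by (simp add: algebra_simps)
  also have "s * a * i = t\<^sup>2 + q * m" using m by (simp add: algebra_simps)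
  finally have sa: "s * a = u * (t\<^sup>2 + q * m)" .
  \<comment> \<open>\<open>\<beta>\<close> is chosen to solve
    \<open>t * c = s * q * (t' * a - \<beta> * c)\<close>, the condition that the right factor have
    lower left entry 0. \<open>A\<close> and \<open>B\<close> form the top row left after removing
    the left factor.\<close>
  define \<beta> where "\<beta> = m * s' * t'"
  define A B where "A = t' * a - \<beta> * c" and "B = t' * b - \<beta> * d"
  have low: "s * q * A = t * c"
  proof -
    have "s * q * A = q * t' * (s * a) - q * m * t' * c * (s * s')"
      unfolding A_def \<beta>_def by (simp add: algebra_simps)
    also have "\<dots> = q * u * t * (t * t')"
      unfolding sa s' c q_def[symmetric] by (simp add: algebra_simps power2_eq_square)
    also have "\<dots> = t * c" unfolding t' c q_def by (simp add: mult_ac)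
    finally show ?thesis .
  qed
  have "zmat a b c d = zmat t \<beta> 0 t' ** zmat 1 0 (s * q) 1 ** zmat A B 0 (t * d - s * q * B)"
  proof -
    have "(t + \<beta> * (s * q)) * A = (t * t') * a + \<beta> * (s * q * A - t * c)"
      unfolding A_def by (simp add: algebra_simps)
    moreover have "(t + \<beta> * (s * q)) * B + \<beta> * (t * d - s * q * B) = (t * t') * b"
      unfolding B_def by (simp add: algebra_simps)
    moreover have "t' * (s * q) * A = (t * t') * c" using low by (simp add: algebra_simps)
    moreover have "t' * (s * q) * B + t' * (t * d - s * q * B) = (t * t') * d"
      by (simp add: algebra_simps)
    ultimately show ?thesis using low t' by (simp add: zmat_mult zmat_eq_iff)
  qed
  moreover have "zmat t \<beta> 0 t' \<in> K0 n" using t' by (simp add: zmat_in_K0_iff)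
  moreover have "A * (t * d - s * q * B) = 1"
  proof -
    have "A * (t * d - s * q * B) = t * A * d - (s * q * A) * B" by (simp add: algebra_simps)
    also have "\<dots> = (t * t') * (a * d - b * c)"
      unfolding low unfolding A_def B_def by (simp add: algebra_simps)
    finally show ?thesis by (simp add: t' det)
  qed
  then have "zmat A B 0 (t * d - s * q * B) \<in> K0 n" by (simp add: zmat_in_K0_iff)
  ultimately show ?thesis unfolding K0_double_coset_def q_def by blast
qed

theorem proposition2p1:
  fixes p n :: nat and l :: "'p::prime_card padic_int"
  assumes "p = CARD('p)" and "odd p"
    and "n \<ge> 2"
    and "l dvd 1"
    and "\<not> (\<exists>x :: 'p padic_int. of_nat p dvd l - x\<^sup>2)"
  shows "double_coset_representatives (metaplectic :: ('p padic_mat \<times> int) monoid)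
    (full_preimage (K0 n)) (full_preimage SL2_Zp) (full_preimage (K0 n))
    ([(mat 1, 1), (w_mat 1, 1)]
      @ map (\<lambda>r. (y_mat (of_nat p ^ r), 1)) [1..<n]
      @ map (\<lambda>r. (y_mat (to_fract l * of_nat p ^ r), 1)) [1..<n])"
proof -
  let ?D = "double_coset (metaplectic :: ('p padic_mat \<times> int) monoid)
    (full_preimage (K0 n)) (full_preimage (K0 n))"
  let ?C = "K0_double_coset n :: 'p padic_mat \<Rightarrow> _"
  let ?I = "zmat 1 0 0 1 :: 'p padic_mat" and ?W = "zmat 0 1 (- 1) 0 :: 'p padic_mat"
  define Y where "Y s r = zmat 1 0 (s * uniformizer ^ r) 1" for s :: "'p padic_int" and r
  define reps where "reps = [?I, ?W] @ map (Y 1) [1..<n] @ map (Y l) [1..<n]"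
  note odd = assms(2)[unfolded assms(1)] and nonsq = assms(5)[unfolded assms(1)]
  have one: "(1 :: 'p padic_int) dvd 1" by simp
  have Y_mat: "y_mat (of_nat p ^ r) = Y 1 r" "y_mat (to_fract l * of_nat p ^ r) = Y l r" for r
    unfolding Y_def assms(1) y_mat_to_fract[symmetric]
    by (simp_all add: to_fract_power to_fract_of_nat)
  have list: "[(mat 1, 1), (w_mat 1, 1)]
      @ map (\<lambda>r. (y_mat (of_nat p ^ r), 1)) [1..<n]
      @ map (\<lambda>r. (y_mat (to_fract l * of_nat p ^ r), 1)) [1..<n] = map (\<lambda>g. (g, 1 :: int)) reps"
    by (simp add: reps_def zmat_1 w_mat_1 Y_mat)
  have D: "?D (g, e) = ?C g \<times> {1, - 1}" if "e \<in> {1, - 1}" for g e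
    using that by (rule double_coset_full_preimage_K0)
  have eq_dvd: "uniformizer ^ j dvd c \<longleftrightarrow> uniformizer ^ j dvd c'"
    if "?C (zmat a b c d) = ?C (zmat a' b' c' d')" "j \<le> n" for a b c d a' b' c' d' j
    using that K0_double_coset_lower_left_dvd K0_double_coset_refl by metis
  \<comment> \<open>The lower left entries are 0, -1 and \<open>s * uniformizer ^ r\<close>.
    Divisibility by p separates -1 from the other two, and divisibility by
    \<open>uniformizer ^ n\<close> separates 0 from the last, as \<open>r < n\<close>.\<close>
  have IW: "?C ?I \<noteq> ?C ?W"
    using eq_dvd[of 1 0 0 1 0 1 "- 1" 0 1] not_uniformizer_dvd_1[where 'p = 'p] assms(3) by auto
  have IY: "?C ?I \<noteq> ?C (Y s r)" if "s dvd 1" "r < n" for s r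
    using eq_dvd[of 1 0 0 1 1 0 "s * uniformizer ^ r" 1 n] that
    by (auto simp: Y_def uniformizer_power_dvd_iff)
  have WY: "?C ?W \<noteq> ?C (Y s r)" if "1 \<le> r" for s r
    using eq_dvd[of 0 1 "- 1" 0 1 0 "s * uniformizer ^ r" 1 1] that assms(3)
      not_uniformizer_dvd_1[where 'p = 'p]
    by (auto simp: Y_def dvd_power)
  have YY: "r = r'" if "?C (Y s r) = ?C (Y s' r')" "s dvd 1" "s' dvd 1" "r < n" "r' < n" for s s' r r'
  proof -
    have "j \<le> r \<longleftrightarrow> j \<le> r'" if "j \<le> n" for j
      using eq_dvd[OF \<open>?C (Y s r) = ?C (Y s' r')\<close>[unfolded Y_def] that]
        \<open>s dvd 1\<close> \<open>s' dvd 1\<close> by (simp add: uniformizer_power_dvd_iff)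
    from this[of r] this[of r'] show ?thesis using that(4,5) by simp
  qed
  \<comment> \<open>Equal orders force \<open>r' = r\<close>. The square class invariant, after
    cancelling \<open>uniformizer ^ r\<close>, would then make \<open>l\<close> a square modulo
    p.\<close>
  have YlY: "?C (Y 1 r) \<noteq> ?C (Y l r')" if r: "1 \<le> r" "r < n" "r' < n" for r r'
  proof
    assume eq: "?C (Y 1 r) = ?C (Y l r')"
    with YY[OF eq one assms(4)] r have "r' = r" by simp
    then have "Y l r \<in> ?C (Y 1 r)" using eq K0_double_coset_refl by metis
    then obtain t where "uniformizer ^ Suc r dvd
        (l * uniformizer ^ r) * 1 - (1 * uniformizer ^ r) * 1 * t\<^sup>2"
      using K0_double_coset_square_class[of 1 0 "l * uniformizer ^ r" 1 n 1 0 "1 * uniformizer ^ r" 1 r] r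
      unfolding Y_def by auto
    then have "uniformizer ^ r * uniformizer dvd uniformizer ^ r * (l - t\<^sup>2)"
      by (simp add: algebra_simps)
    then have "uniformizer dvd l - t\<^sup>2"
      using uniformizer_nonzero[where 'p = 'p] by simp
    then show False using nonsq by blast
  qed
  have distinct: "distinct (map ?C reps)"
  proof -
    have "?C ?I \<notin> (\<lambda>r. ?C (Y s r)) ` set [1..<n]" if "s dvd 1" for s
    proof (rule notI, elim imageE)
      fix r assume "?C ?I = ?C (Y s r)" "r \<in> set [1..<n]"
      then show False using IY[OF that, of r] by simp
    qed
    moreover have "?C ?W \<notin> (\<lambda>r. ?C (Y s r)) ` set [1..<n]" for s
    proof (rule notI, elim imageE)
      fix r assume "?C ?W = ?C (Y s r)" "r \<in> set [1..<n]"
      then show False using WY[of r s] by simp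
    qed
    moreover have "inj_on (\<lambda>r. ?C (Y s r)) (set [1..<n])" if "s dvd 1" for s
      using YY[of s _ s] that by (intro inj_onI) simp
    moreover have "(\<lambda>r. ?C (Y 1 r)) ` set [1..<n] \<inter> (\<lambda>r. ?C (Y l r)) ` set [1..<n] = {}"
    proof (rule equals0I, elim IntE imageE)
      fix X r r' assume "X = ?C (Y 1 r)" "X = ?C (Y l r')" "r \<in> set [1..<n]" "r' \<in> set [1..<n]"
      then show False using YlY[of r r'] by simp
    qed
    ultimately show ?thesis
      unfolding reps_def using IW one assms(4) by (simp add: distinct_map comp_def)
  qed
  have reps_SL2: "set reps \<subseteq> SL2_Zp"
    by (auto simp: reps_def Y_def zmat_in_SL2_Zp_iff)
  have complete: "\<exists>x \<in> set reps. g \<in> ?C x" if gK: "g \<in> SL2_Zp" for g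
  proof -
    obtain a b c d where g: "g = zmat a b c d" "a * d - b * c = 1"
      using gK by (rule SL2_Zp_cases)
    consider "uniformizer ^ n dvd c" | r u where "r < n" "u dvd 1" "c = uniformizer ^ r * u"
      by (rule padic_truncated_factorization)
    then show ?thesis
    proof cases
      case 1
      then have "g \<in> K0 n" by (simp add: g zmat_in_K0_iff)
      moreover have "g = g ** mat 1 ** mat 1" by simp
      ultimately have "g \<in> ?C ?I"
        unfolding K0_double_coset_def zmat_1[symmetric] using one_in_K0 by blast
      then show ?thesis by (simp add: reps_def)
    next
      case (2 r u)
      show ?thesis
      proof (cases "r = 0")
        case True
        then have "g \<in> ?C ?W" using 2 g K0_double_coset_big_cell by simp
        then show ?thesis by (simp add: reps_def)
      next
        case False
        then have r: "1 \<le> r" "r \<in> set [1..<n]" using 2 by auto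
        \<comment> \<open>As p divides \<open>c\<close>, the determinant condition makes
          \<open>a\<close> a unit.\<close>
        have "uniformizer dvd c" using 2 False by (simp add: dvd_power)
        then have "\<not> uniformizer dvd a"
          using g(2) not_uniformizer_dvd_1[where 'p = 'p] by (metis dvd_diff dvd_mult dvd_mult2)
        then have "a * u dvd 1"
          using mult_dvd_mono[of a 1 u 1] 2 by (simp add: padic_unit_iff)
        \<comment> \<open>\<open>s\<close> is 1 if \<open>a * u\<close> is a square modulo p, and
          \<open>l\<close> otherwise.\<close>
        with padic_nonsquare_mult[OF odd assms(4) _ nonsq]
        obtain s x where s: "s \<in> {1, l}" and x: "uniformizer dvd s * (a * u) - x\<^sup>2"
          by (metis insertCI mult_1)
        have "s dvd 1" using s assms(4) by auto
        then have "g \<in> ?C (Y s r)"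
          unfolding g Y_def
          using K0_double_coset_lower_unipotent[OF odd g(2) 2(3,2) r(1)] x by blast
        moreover have "Y s r \<in> set reps" using r s by (auto simp: reps_def)
        ultimately show ?thesis by blast
      qed
    qed
  qed
  have preimage: "full_preimage SL2_Zp = (SL2_Zp :: 'p padic_mat set) \<times> {1, - 1 :: int}"
    by (auto simp: full_preimage_def metaplectic_def SL2_Zp_def)
  have map_D: "map ?D (map (\<lambda>g. (g, 1)) reps) = map (\<lambda>g. ?C g \<times> {1, - 1}) reps"
    by (simp add: D)
  have "distinct (map ?D (map (\<lambda>g. (g, 1)) reps))"
  proof -
    \<comment> \<open>Projection to the first component recovers a double coset from its preimage,
      so distinctness passes from the linear group to the cover.\<close>
    have "inj_on (\<lambda>X. X \<times> {1, - 1 :: int}) (set (map ?C reps))"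
      by (rule inj_on_inverseI[of _ "\<lambda>Z. fst ` Z"]) simp
    with distinct have "distinct (map (\<lambda>X. X \<times> {1, - 1 :: int}) (map ?C reps))"
      by (subst distinct_map) simp
    then show ?thesis unfolding map_D by (simp add: comp_def)
  qed
  moreover have "set (map (\<lambda>g. ?C g \<times> {1, - 1 :: int}) reps) = ?D ` full_preimage SL2_Zp"
  proof
    show "set (map (\<lambda>g. ?C g \<times> {1, - 1 :: int}) reps) \<subseteq> ?D ` full_preimage SL2_Zp"
    proof
      fix X assume "X \<in> set (map (\<lambda>g. ?C g \<times> {1, - 1 :: int}) reps)"
      then obtain g where "g \<in> set reps" "X = ?D (g, 1)" by (auto simp: D)
      then show "X \<in> ?D ` full_preimage SL2_Zp"
        using reps_SL2 unfolding preimage by blast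
    qed
    show "?D ` full_preimage SL2_Zp \<subseteq> set (map (\<lambda>g. ?C g \<times> {1, - 1 :: int}) reps)"
    proof
      fix X assume "X \<in> ?D ` full_preimage SL2_Zp"
      then obtain g e where "g \<in> SL2_Zp" "e \<in> {1, - 1}" "X = ?D (g, e)"
        unfolding preimage by blast
      moreover obtain x where "x \<in> set reps" "g \<in> ?C x"
        using complete \<open>g \<in> SL2_Zp\<close> by blast
      ultimately have "X = ?C x \<times> {1, - 1}" by (simp add: D K0_double_coset_eq)
      then show "X \<in> set (map (\<lambda>g. ?C g \<times> {1, - 1 :: int}) reps)"
        using \<open>x \<in> set reps\<close> by simp
    qed
  qed
  moreover have "set (map (\<lambda>g. (g, 1)) reps) \<subseteq> full_preimage SL2_Zp"
    using reps_SL2 unfolding preimage by auto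
  ultimately show ?thesis
    unfolding double_coset_representatives_def list map_D by (intro conjI)
qed

end
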